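(* Let $k\ge 3$ be an integer. If $G$ is a $C_{2k}$-free graph with $\Delta(G)\ge 1$, then $\omega'_S(G)\le (2k-1)\Delta(G)+(2k-1)^2$.
   Context: All graphs are finite and simple. $\Delta(G)$ is the maximum degree of $G$. $C_n$ denotes the cycle on $n$ vertices; a graph is $F$-free if it contains no subgraph (not necessarily induced) isomorphic to $F$. The distance between two edges of $G$ is the distance between the corresponding vertices in the line graph of $G$. A strong clique of $G$ is a set $S$ of edges such that every pair of edges in $S$ has distance at most $2$. The strong clique number $\omega'_S(G)$ is the maximum size of a strong clique of $G$. *)

theory Defs
  imports Main "HOL-Library.Extended_Nat"
begin

text \<open>A graph is a pair of a vertex set and a set of edges, an edge being a set of two vertices.\<close>

type_synonym 'a ugraph = "'a set \<times> 'a set set"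

abbreviation verts :: "'a ugraph \<Rightarrow> 'a set" where
  "verts G \<equiv> fst G"

abbreviation edges :: "'a ugraph \<Rightarrow> 'a set set" where
  "edges G \<equiv> snd G"

definition simple_graph :: "'a ugraph \<Rightarrow> bool" where
  "simple_graph G \<longleftrightarrow> finite (verts G) \<and> (\<forall>e\<in>edges G. e \<subseteq> verts G \<and> card e = 2)"

definition degree :: "'a ugraph \<Rightarrow> 'a \<Rightarrow> nat" where
  "degree G v = card {e \<in> edges G. v \<in> e}"

text \<open>Inserting 0 only matters for the graph without vertices, whose maximum degree is then 0.\<close>

definition max_degree :: "'a ugraph \<Rightarrow> nat" where
  "max_degree G = Max (insert 0 (degree G ` verts G))"

definition subgraph :: "'a ugraph \<Rightarrow> 'a ugraph \<Rightarrow> bool" where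
  "subgraph H G \<longleftrightarrow> simple_graph H \<and> verts H \<subseteq> verts G \<and> edges H \<subseteq> edges G"

definition isomorphic :: "'a ugraph \<Rightarrow> 'b ugraph \<Rightarrow> bool" where
  "isomorphic G H \<longleftrightarrow>
    (\<exists>f. bij_betw f (verts G) (verts H) \<and> edges H = (\<lambda>e. f ` e) ` edges G)"

definition graph_free :: "'a ugraph \<Rightarrow> 'b ugraph \<Rightarrow> bool" where
  "graph_free F G \<longleftrightarrow> \<not> (\<exists>H. subgraph H G \<and> isomorphic F H)"

text \<open>Meaningful for \<open>n \<ge> 3\<close> only.\<close>

definition cycle_graph :: "nat \<Rightarrow> nat ugraph" where
  "cycle_graph n = ({..<n}, {{i, Suc i mod n} | i. i < n})"

definition walk :: "'a ugraph \<Rightarrow> 'a list \<Rightarrow> bool" where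
  "walk G xs \<longleftrightarrow>
    xs \<noteq> [] \<and> set xs \<subseteq> verts G \<and> successively (\<lambda>u v. {u, v} \<in> edges G) xs"

text \<open>The distance is \<open>\<infinity>\<close> if no walk joins the two vertices.\<close>

definition distance :: "'a ugraph \<Rightarrow> 'a \<Rightarrow> 'a \<Rightarrow> enat" where
  "distance G u v =
    (INF xs \<in> {xs. walk G xs \<and> hd xs = u \<and> last xs = v}. enat (length xs - 1))"

definition line_graph :: "'a ugraph \<Rightarrow> 'a set ugraph" where
  "line_graph G =
    (edges G, {{e, f} | e f. e \<in> edges G \<and> f \<in> edges G \<and> e \<noteq> f \<and> e \<inter> f \<noteq> {}})"

definition edge_distance :: "'a ugraph \<Rightarrow> 'a set \<Rightarrow> 'a set \<Rightarrow> enat" where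
  "edge_distance G e f = distance (line_graph G) e f"

definition strong_clique :: "'a ugraph \<Rightarrow> 'a set set \<Rightarrow> bool" where
  "strong_clique G S \<longleftrightarrow> S \<subseteq> edges G \<and> (\<forall>e\<in>S. \<forall>f\<in>S. edge_distance G e f \<le> 2)"

definition strong_clique_number :: "'a ugraph \<Rightarrow> nat" where
  "strong_clique_number G = Max {card S | S. strong_clique G S}"

end

theory Submission
  imports Defs
begin

text \<open>
  The heart of the matter is that the vertices of a matching of \<open>2 k\<close> edges, any two of them joined by an
  edge, span a cycle of length \<open>2 k\<close>. Hence a strong clique of a \<open>C\<^bsub>2k\<^esub>\<close>-free graph has matching
  number \<open>m \<le> 2 k - 1\<close>. For a maximum matching, every matching edge has an end with at most one edge
  of the clique leaving the matched vertices (otherwise augment), so the other ends cover all but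
  \<open>m\<^sup>2\<close> edges of the clique.

  The matching statement is proved by induction on \<open>k\<close>. Suppose there is no cycle of length \<open>2 k + 2\<close>, and
  take a cycle of length \<open>2 k\<close> meeting as many matching edges as possible. If it contains no matching
  edge, then every unused matching edge has an end adjacent to the whole cycle, and two of them
  can be inserted. If it contains \<open>c > 0\<close> matching edges, then \<open>c + 2\<close> matching edges are unused, and two of
  these are attached in the same way to a matching edge \<open>b\<close> on the cycle. Inserting both of them near \<open>b\<close>
  and another matching edge of the cycle rules out \<open>c > 1\<close>; for \<open>c = 1\<close>, attempts to insert one of
  them while skipping at most two vertices determine its neighbours around the cycle, up to a
  contradiction.
\<close>

section \<open>Weighted cycles of matching edges\<close>

text \<open>
  The elements are the matching edges, each with two ends named by the truth values; between \<open>i\<close> and \<open>j\<close>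
  one connecting edge is selected, and \<open>S i j\<close> is its end at \<open>i\<close>. A list of matching edges then
  determines a cycle of the graph, which passes through one end of \<open>j\<close> if it enters and leaves \<open>j\<close> at the
  same end, and traverses \<open>j\<close> otherwise: \<open>turn\<close> counts the vertices, and \<open>weight\<close> is the length.
\<close>

locale sides =
  fixes S :: "'a \<Rightarrow> 'a \<Rightarrow> bool"
begin

definition turn :: "'a \<Rightarrow> 'a \<Rightarrow> 'a \<Rightarrow> nat" where
  "turn i j l = (if S j i = S j l then 1 else 2)"

fun turns :: "'a list \<Rightarrow> nat" where
  "turns (i # j # l # xs) = turn i j l + turns (j # l # xs)"
| "turns _ = 0"

text \<open>Repeating the first two elements makes every element of a list of length at least 2 the
  middle of exactly one triple.\<close>

definition weight :: "'a list \<Rightarrow> nat" where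
  "weight xs = turns (xs @ take 2 xs)"

section \<open>Rotation, reversal and splitting of weights\<close>

lemma turn_commute: "turn i j l = turn l j i"
  by (auto simp: turn_def)

text \<open>The two lists overlap in two elements, so each consecutive triple lies in exactly one of
  them.\<close>

lemma turns_append: "turns (us @ a # b # vs) = turns (us @ [a, b]) + turns (a # b # vs)"
proof (induction us)
  case (Cons u us)
  then show ?case by (cases us; cases "tl us") auto
qed simp

lemma turns_rev: "turns (rev xs) = turns xs"
proof (induction xs rule: turns.induct)
  case (1 i j l xs)
  have "turns (rev (i # j # l # xs)) = turns (rev xs @ l # j # [i])" by simp
  also have "\<dots> = turns (rev (j # l # xs)) + turn l j i"
    by (subst turns_append) simp
  finally show ?case using 1 by (simp add: turn_commute)
qed auto

lemma weight_rotate: "weight (us @ vs) = weight (vs @ us)"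
proof -
  have rot1: "weight (x # xs) = weight (xs @ [x])" for x xs
  proof (cases xs)
    case (Cons y zs)
    obtain h hs where h: "zs @ [x] = h # hs" by (cases zs) auto
    have "weight (x # xs) = turn x y h + turns (y # zs @ [x, y])"
      using Cons h by (cases zs) (auto simp: weight_def numeral_2_eq_2)
    moreover have "weight (xs @ [x]) = turns ((y # zs) @ x # y # [h])"
      using Cons h by (cases zs) (auto simp: weight_def numeral_2_eq_2)
    ultimately show ?thesis using turns_append[of "y # zs" x y "[h]"] by simp
  qed simp
  show ?thesis
  proof (induction us arbitrary: vs)
    case (Cons u us)
    have "weight ((u # us) @ vs) = weight (us @ (vs @ [u]))" using rot1[of u "us @ vs"] by simp
    also have "\<dots> = weight (vs @ u # us)" using Cons[of "vs @ [u]"] by simp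
    finally show ?case .
  qed simp
qed

lemma weight_rev: "weight (rev xs) = weight xs"
proof (cases xs rule: turns.cases)
  case (1 x y z zs)
  have "weight (rev xs) = weight ([y, x] @ rev (z # zs))"
    using weight_rotate[of "rev (z # zs)" "[y, x]"] 1 by simp
  also have "\<dots> = turns (rev ([x, y] @ (z # zs) @ [x, y]))" by (simp add: weight_def numeral_2_eq_2)
  also have "\<dots> = weight xs" by (simp only: turns_rev) (simp add: 1 weight_def numeral_2_eq_2)
  finally show ?thesis .
next
  case ("2_3" x y)
  then show ?thesis using weight_rotate[of "[x]" "[y]"] by simp
qed auto

text \<open>Only the first summand depends on \<open>ys\<close>, so cycles that differ only between
  \<open>x\<close> and \<open>z\<close> can be compared by their turns there.\<close>

lemma weight_segment:
  "weight (x # ys @ z # zs) = turns (last (z # zs) # x # ys @ [z, hd (zs @ [x])]) + turns (z # zs @ [x])"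
proof (cases zs rule: rev_cases)
  case Nil
  then show ?thesis using weight_rotate[of "x # ys" "[z]"] by (simp add: weight_def numeral_2_eq_2)
next
  case (snoc zs' w)
  obtain h hs where h: "zs' @ [w] = h # hs" by (cases zs') auto
  have "weight (x # ys @ z # zs) = weight (w # x # ys @ z # zs')"
    using weight_rotate[of "x # ys @ z # zs'" "[w]"] snoc by simp
  also have "\<dots> = turns ((w # x # ys) @ z # h # hs @ [x])"
    using h by (simp add: weight_def numeral_2_eq_2)
      (metis append.assoc append_Cons append_Nil)
  also have "\<dots> = turns ((w # x # ys) @ [z, h]) + turns (z # h # hs @ [x])"
    by (rule turns_append)
  finally show ?thesis using h snoc by (cases zs') auto
qed

lemma turns_conv_sum:
  "turns xs = (\<Sum>i<length xs - 2. turn (xs ! i) (xs ! Suc i) (xs ! Suc (Suc i)))"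
proof (induction xs rule: turns.induct)
  case (1 i j l xs)
  show ?case by (simp add: 1 sum.lessThan_Suc_shift del: sum.lessThan_Suc)
qed auto

lemma weight_conv_sum:
  assumes "2 \<le> length xs"
  defines "x \<equiv> \<lambda>i. xs ! (i mod length xs)"
  shows "weight xs = (\<Sum>i<length xs. turn (x i) (x (Suc i)) (x (Suc (Suc i))))"
proof -
  have nth: "(xs @ take 2 xs) ! i = x i" if "i < length xs + 2" for i
    using that assms by (auto simp: x_def nth_append mod_if)
  show ?thesis using assms(1)
    by (auto simp: weight_def turns_conv_sum nth intro!: sum.cong)
qed

lemma turns_straight:
  assumes "\<And>us x y z vs. xs = us @ x # y # z # vs \<Longrightarrow> S y x = S y z"
  shows "turns xs = length xs - 2"
  using assms
proof (induction xs rule: turns.induct)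
  case (1 i j l xs)
  have "turns (j # l # xs) = length (j # l # xs) - 2"
    by (rule "1.IH") (metis "1.prems" append_Cons)
  moreover have "S j i = S j l" using "1.prems"[of "[]"] by simp
  ultimately show ?case by (simp add: turn_def)
qed auto

lemma turns_map_upt:
  "turns (map X [i..<i + d + 2]) = (\<Sum>j<d. turn (X (i + j)) (X (i + j + 1)) (X (i + j + 2)))"
  unfolding turns_conv_sum by (intro sum.cong) (simp_all del: upt_Suc)

lemma turn_ge_1: "1 \<le> turn i j k"
  by (simp add: turn_def)

definition cycle_in :: "'a set \<Rightarrow> 'a list \<Rightarrow> bool" where
  "cycle_in I xs \<longleftrightarrow> distinct xs \<and> set xs \<subseteq> I \<and> 3 \<le> length xs"

end

section \<open>The induction step\<close>

text \<open>
  The situation of the induction step, refuted below. An element \<open>b\<close> with neighbours \<open>p\<close> and \<open>n\<close> on the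
  cycle is called reversing if \<open>S b p \<noteq> S b n\<close>, that is, if the cycle traverses \<open>b\<close>; otherwise it is straight.
\<close>

locale longest_cycle = sides S for S :: "'a \<Rightarrow> 'a \<Rightarrow> bool" +
  fixes I :: "'a set" and l r :: nat
  assumes weight_neq: "cycle_in I xs \<Longrightarrow> weight xs \<noteq> l + 2"
    and length_le: "cycle_in I xs \<Longrightarrow> weight xs = l \<Longrightarrow> length xs \<le> r"
begin

definition longest :: "'a list \<Rightarrow> bool" where
  "longest xs \<longleftrightarrow> cycle_in I xs \<and> weight xs = l \<and> length xs = r"

lemma longest_rotate: "longest (us @ vs) \<Longrightarrow> longest (vs @ us)"
  using weight_rotate[of us vs] by (auto simp: longest_def cycle_in_def)

lemma longest_rotate1: "longest (x # xs) \<Longrightarrow> longest (xs @ [x])"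
  using longest_rotate[of "[x]" xs] by simp

lemma longest_rev: "longest xs \<Longrightarrow> longest (rev xs)"
  by (auto simp: longest_def cycle_in_def weight_rev)

lemma weight_insert1:
  assumes "longest (x # zs)" "e \<in> I - set (x # zs)"
  shows "weight (x # e # zs) \<noteq> l" "weight (x # e # zs) \<noteq> l + 2"
proof -
  have "cycle_in I (x # e # zs)" "length (x # e # zs) = Suc r"
    using assms by (auto simp: longest_def cycle_in_def)
  then show "weight (x # e # zs) \<noteq> l" "weight (x # e # zs) \<noteq> l + 2"
    using weight_neq[of "x # e # zs"] length_le[of "x # e # zs"] by auto
qed

text \<open>
  If \<open>e\<close> is attached to the outer ends of the consecutive reversing elements \<open>b\<close>, \<open>n\<close>, inserting it shortens the
  cycle by 1. Inserting any other \<open>f\<close> before \<open>b\<close> as well changes the weight by 0 or 2 in total.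
\<close>

lemma no_reversing_pair:
  assumes "longest (p # b # n # zs)"
    and "e \<in> I - set (p # b # n # zs)" "f \<in> I - set (p # b # n # zs)" "e \<noteq> f"
    and "S b p \<noteq> S b n" "S n b \<noteq> S n (hd (zs @ [p]))" "S b e = S b p"
  shows "S n e = S n b"
proof (rule ccontr)
  assume ne: "S n e \<noteq> S n b"
  define w v where "w = last (n # zs)" and "v = hd (zs @ [p])"
  note seg = weight_segment[of p _ n zs, folded w_def v_def]
  have "weight (p # [b] @ n # zs) = l" using assms(1) by (simp add: longest_def)
  moreover have "weight (b # e # n # zs @ [p]) \<noteq> l"
    using weight_insert1[of b "n # zs @ [p]" e] longest_rotate1[OF assms(1)] assms(2) by simp
  then have "weight (p # [b, e] @ n # zs) \<noteq> l"
    using weight_rotate[of "[p]" "b # e # n # zs"] by simp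
  moreover have "weight (p # [f, b] @ n # zs) \<noteq> l" "weight (p # [f, b] @ n # zs) \<noteq> l + 2"
    using weight_insert1[OF assms(1) assms(3)] by auto
  moreover have "cycle_in I (p # [f, b, e] @ n # zs)" "length (p # [f, b, e] @ n # zs) = r + 2"
    using assms(1-4) by (auto simp: longest_def cycle_in_def)
  then have "weight (p # [f, b, e] @ n # zs) \<noteq> l + 2" "weight (p # [f, b, e] @ n # zs) \<noteq> l"
    using weight_neq length_le by force+
  ultimately show False
    using assms(5-7)[folded v_def] ne unfolding seg
    unfolding append.simps turns.simps turn_def
    by (auto split: if_splits)
qed

lemma longest_flip: "longest (p # b # n # zs) \<Longrightarrow> longest (n # b # p # rev zs)"
  using longest_rotate[of "rev zs" "[n, b, p]"] longest_rev[of "p # b # n # zs"] by simp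

text \<open>Inserting \<open>e\<close> saves 1 at \<open>b\<close>, adds 1 or 2 at \<open>e\<close>,
  and adds 0 or 1 at \<open>n\<close>; that nothing is saved at \<open>n\<close> is clear if
  \<open>n\<close> is straight and is \<open>no_reversing_pair\<close> otherwise. Of the totals 0,
  1, 2 only 1 is allowed.\<close>

lemma weight_insert_after:
  assumes "longest (p # b # n # zs)"
    and "e \<in> I - set (p # b # n # zs)" "f \<in> I - set (p # b # n # zs)" "e \<noteq> f"
    and "S b p \<noteq> S b n" "S b e = S b p"
  shows "weight (p # b # e # n # zs) = l + 1"
proof -
  define w v where "w = last (n # zs)" and "v = hd (zs @ [p])"
  note seg = weight_segment[of p _ n zs, folded w_def v_def]
  have "longest (b # n # zs @ [p])" using longest_rotate1[OF assms(1)] by simp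
  then have "weight (p # [b, e] @ n # zs) \<noteq> l" "weight (p # [b, e] @ n # zs) \<noteq> l + 2"
    using weight_insert1[of b "n # zs @ [p]" e] assms(2) weight_rotate[of "[p]" "b # e # n # zs"]
    by auto
  moreover have "weight (p # [b] @ n # zs) = l" using assms(1) by (simp add: longest_def)
  moreover have "S n e = S n b" if "S n b \<noteq> S n v"
    using no_reversing_pair[OF assms(1-5) that[unfolded v_def] assms(6)] .
  ultimately have "weight (p # [b, e] @ n # zs) = l + 1"
    using assms(5,6) unfolding seg
    unfolding append.simps turns.simps turn_def
    by (auto split: if_splits)
  then show ?thesis by simp
qed

lemma weight_insert_before:
  assumes "longest (p # b # n # zs)"
    and "e \<in> I - set (p # b # n # zs)" "f \<in> I - set (p # b # n # zs)" "e \<noteq> f"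
    and "S b p \<noteq> S b n" "S b e = S b n"
  shows "weight (p # e # b # n # zs) = l + 1"
proof -
  have "weight (n # b # e # p # rev zs) = l + 1"
    using weight_insert_after[OF longest_flip[OF assms(1)], of e f] assms by auto
  also have "weight (n # b # e # p # rev zs) = weight (rev zs @ [n, b, e, p])"
    using weight_rotate[of "[n, b, e, p]"] by simp
  also have "\<dots> = weight (p # e # b # n # zs)"
    using weight_rev[of "p # e # b # n # zs"] by simp
  finally show ?thesis .
qed

text \<open>Inserting \<open>e\<close> after \<open>b\<close> gains 1. The gain of \<open>f\<close>
  before \<open>b\<close> is independent of this, as \<open>f\<close> and \<open>p\<close> are
  attached to the same end of \<open>b\<close>. It lies between 0 and 3, is neither 0 nor 2, and is
  not 1 because of the sum. So it is 3, which makes \<open>p\<close> straight with \<open>f\<close>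
  attached to its other end. Exchange \<open>e\<close> and \<open>f\<close>.\<close>

lemma same_state:
  assumes "longest (p # b # n # zs)"
    and "e \<in> I - set (p # b # n # zs)" "f \<in> I - set (p # b # n # zs)" "e \<noteq> f"
    and "S b p \<noteq> S b n" "S b e = S b p" "S b f = S b p"
  shows "S p (last (n # zs)) = S p b" "S p e \<noteq> S p b" "S n e = S n b"
proof -
  define w v where "w = last (n # zs)" and "v = hd (zs @ [p])"
  note seg = weight_segment[of p _ n zs, folded w_def v_def]
  have e0: "weight (p # [b] @ n # zs) = l" using assms(1) by (simp add: longest_def)
  have *: "S p w = S p b \<and> S p f \<noteq> S p b"
    if ef: "e \<in> I - set (p # b # n # zs)" "f \<in> I - set (p # b # n # zs)" "e \<noteq> f"
      and st: "S b e = S b p" "S b f = S b p" for e f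
  proof -
    have "weight (p # [f, b] @ n # zs) \<noteq> l" "weight (p # [f, b] @ n # zs) \<noteq> l + 2"
      using weight_insert1[OF assms(1) ef(2)] by auto
    moreover have "weight (p # [f, b, e] @ n # zs) \<noteq> l + 2"
      using assms(1) ef by (intro weight_neq) (auto simp: longest_def cycle_in_def)
    moreover have "weight (p # [b, e] @ n # zs) = l + 1"
      using weight_insert_after[OF assms(1) ef assms(5) st(1)] by simp
    ultimately show ?thesis
      using e0 assms(5) st unfolding seg
      unfolding append.simps turns.simps turn_def
      by (auto split: if_splits)
  qed
  show 1: "S p (last (n # zs)) = S p b" "S p e \<noteq> S p b"
    using *[of f e] assms unfolding w_def by auto
  show "S n e = S n b"
  proof (cases "S n b = S n v")
    case True
    have "weight (p # [e, b] @ n # zs) \<noteq> l + 2"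
      using weight_insert1(2)[OF assms(1,2)] by simp
    moreover have "weight (p # [b, e] @ n # zs) = l + 1"
      using weight_insert_after[OF assms(1-6)] by simp
    \<comment> \<open>If \<open>S n e \<noteq> S n b\<close>, the preceding facts give
      \<open>S e p \<noteq> S e n\<close>, and putting \<open>e\<close> in place of \<open>b\<close>
      would gain 2.\<close>
    moreover have "weight (p # [e] @ n # zs) \<noteq> l + 2"
      using assms(1,2) by (intro weight_neq) (auto simp: longest_def cycle_in_def)
    ultimately show ?thesis
      using e0 assms(5,6) 1[folded w_def] True unfolding seg
      unfolding append.simps turns.simps turn_def
      by (auto split: if_splits)
  next
    case False
    then show ?thesis using no_reversing_pair[OF assms(1-5)] assms(6) unfolding v_def by blast
  qed
qed

text \<open>If \<open>S n e = S n b\<close>, then having \<open>e\<close> instead of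
  \<open>b\<close> before \<open>n\<close> does not affect the turn at \<open>n\<close>, so the two
  gains would add up to 2.\<close>

lemma insert2_adjacent:
  assumes "longest (b # n # y # zs)"
    and "e \<in> I - set (b # n # y # zs)" "f \<in> I - set (b # n # y # zs)" "e \<noteq> f"
    and "weight (b # e # n # y # zs) = l + 1" "weight (b # n # f # y # zs) = l + 1"
  shows "S n e \<noteq> S n b"
proof
  assume ne: "S n e = S n b"
  define w v where "w = last (y # zs)" and "v = hd (zs @ [b])"
  note seg = weight_segment[of b _ y zs, folded w_def v_def]
  have "weight (b # [e, n, f] @ y # zs) \<noteq> l + 2"
    using assms(1-4) by (intro weight_neq) (auto simp: longest_def cycle_in_def)
  moreover have "weight (b # [n] @ y # zs) = l" "weight (b # [e, n] @ y # zs) = l + 1"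
    "weight (b # [n, f] @ y # zs) = l + 1"
    using assms(1,5,6) by (auto simp: longest_def)
  ultimately show False
    using ne unfolding seg
    unfolding append.simps turns.simps turn_def
    by (auto split: if_splits)
qed

text \<open>The gaps \<open>b\<close>, \<open>n\<close> and \<open>x\<close>, \<open>y\<close> have
  no element in common, so the gains would add up to 2.\<close>

lemma insert2_apart:
  assumes "longest (b # n # us @ x # y # vs)"
    and "e \<in> I - set (b # n # us @ x # y # vs)" "f \<in> I - set (b # n # us @ x # y # vs)" "e \<noteq> f"
    and "weight (b # e # n # us @ x # y # vs) = l + 1"
  shows "weight (b # n # us @ x # f # y # vs) \<noteq> l + 1"
proof
  assume f: "weight (b # n # us @ x # f # y # vs) = l + 1"
  have c: "cycle_in I (b # e # n # us @ x # f # y # vs)"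
    using assms(1-4) by (auto simp: longest_def cycle_in_def)
  have "l = weight (b # n # us @ x # y # vs)" using assms(1) by (simp add: longest_def)
  moreover have "hd ((us @ x # y # vs) @ [b]) = hd ((us @ x # f # y # vs) @ [b])"
    by (cases us) auto
  ultimately show False
    using assms(5) f weight_neq[OF c]
      weight_segment[of b "[]" n "us @ x # y # vs"] weight_segment[of b "[e]" n "us @ x # y # vs"]
      weight_segment[of b "[]" n "us @ x # f # y # vs"] weight_segment[of b "[e]" n "us @ x # f # y # vs"]
    by (auto split: if_splits)
qed

text \<open>Otherwise inserting \<open>f\<close> before or after \<open>y\<close>, depending on
  \<open>S y f\<close>, gains 1, as does \<open>e\<close> after \<open>b\<close>. The two gaps are
  disjoint or share one element; if they coincide, \<open>no_reversing_pair\<close> applies.\<close>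

lemma other_blocks_straight:
  assumes "longest (b # n # zs @ [p])"
    and ef: "e \<in> I - set (b # n # zs @ [p])" "f \<in> I - set (b # n # zs @ [p])" "e \<noteq> f"
    and b: "S b p \<noteq> S b n" "S b e = S b p" "S b f = S b p"
    and split: "b # n # zs @ [p] = us @ x # y # z # vs"
  shows "S y x = S y z"
proof (rule ccontr)
  assume y: "S y x \<noteq> S y z"
  have L: "longest (p # b # n # zs)" using longest_rotate[of "b # n # zs" "[p]"] assms(1) by simp
  have ef': "e \<in> I - set (p # b # n # zs)" "f \<in> I - set (p # b # n # zs)" using ef by auto
  have we: "weight (b # e # n # zs @ [p]) = l + 1"
    using weight_insert_after[OF L ef' ef(3) b(1,2)] weight_rotate[of "[p]" "b # e # n # zs"] by simp
  have ne: "S n e = S n b" using same_state(3)[OF L ef' ef(3) b] .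
  have R: "longest (x # y # z # vs @ us)"
    using longest_rotate[of us "x # y # z # vs"] assms(1) split by simp
  have ef2: "e \<in> I - set (x # y # z # vs @ us)" "f \<in> I - set (x # y # z # vs @ us)"
    using ef arg_cong[OF split, of set] by auto
  show False
  proof (cases "S y f = S y x")
    case True
    have wf: "weight (us @ x # y # f # z # vs) = l + 1"
      using weight_insert_after[OF R ef2(2,1) ef(3)[symmetric] y True]
        weight_rotate[of us "x # y # f # z # vs"] by simp
    show False
    proof (cases us)
      case Nil
      then show False using insert2_adjacent[of b n z vs e f] split assms(1) ef we wf ne by auto
    next
      case (Cons u us')
      then obtain ws where ws: "us @ [x] = b # n # ws" using split by (cases us') auto
      have us: "us @ x # w = b # n # ws @ w" for w using arg_cong[OF ws, of "\<lambda>xs. xs @ w"] by simp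
      have zs: "zs @ [p] = ws @ y # z # vs" using split us by simp
      show False
        using insert2_apart[of b n ws y z vs e f] assms(1) ef we wf unfolding us zs by simp
    qed
  next
    case False
    then have wf: "weight (us @ x # f # y # z # vs) = l + 1"
      using weight_insert_before[OF R ef2(2,1) ef(3)[symmetric] y]
        weight_rotate[of us "x # f # y # z # vs"] y by simp
    consider "us = []" | "us = [b]" | us' where "us = b # n # us'"
      using split by (cases us; cases "tl us") auto
    then show False
    proof cases
      case 1
      then have "S n f = S n b"
        using no_reversing_pair[OF L ef'(2,1) ef(3)[symmetric] b(1)] y split b by (cases zs) auto
      then show False using False 1 split by auto
    next
      case 2
      then show False using insert2_adjacent[of b n y "z # vs" e f] split assms(1) ef we wf ne by auto
    next
      case 3
      then show False using insert2_apart[of b n us' x y "z # vs" e f] split assms(1) ef we wf by auto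
    qed
  qed
qed

text \<open>Only \<open>b\<close> contributes 2. Its neighbour \<open>p\<close> ends the list, so
  \<open>other_blocks_straight\<close> does not cover it and \<open>same_state\<close> is used
  instead.\<close>

lemma weight_one_reversal:
  assumes "longest (b # n # zs @ [p])"
    and "e \<in> I - set (b # n # zs @ [p])" "f \<in> I - set (b # n # zs @ [p])" "e \<noteq> f"
    and "S b p \<noteq> S b n" "S b e = S b p" "S b f = S b p"
  shows "l = r + 1"
proof -
  have L: "longest (p # b # n # zs)" using longest_rotate[of "b # n # zs" "[p]"] assms(1) by simp
  have p: "S p (last (n # zs)) = S p b" using same_state(1)[OF L _ _ assms(4-7)] assms(2,3) by auto
  have "turns (b # n # zs @ [p]) = length (b # n # zs @ [p]) - 2"
    by (rule turns_straight) (rule other_blocks_straight[OF assms])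
  moreover obtain ws q where q: "b # n # zs = ws @ [q]" "q = last (n # zs)"
    by (metis append_butlast_last_id last_ConsR list.discI)
  have ws: "b # n # zs @ w = ws @ q # w" for w using arg_cong[OF q(1), of "\<lambda>xs. xs @ w"] by simp
  have "turns (b # n # zs @ [p, b, n]) = turns (b # n # zs @ [p]) + turns (q # p # b # [n])"
    using turns_append[of ws q p "[b, n]"] unfolding ws by simp
  ultimately show ?thesis using assms(1,5) p q(2)
    by (simp add: longest_def weight_def turn_def numeral_2_eq_2)
qed

end

text \<open>
  An unused element \<open>e\<close> is connected to the \<open>i\<close>th element of the cycle. In the next two lemmas \<open>p i\<close> is the end
  of this connection at \<open>e\<close>, and \<open>q i\<close> says that its other end is not the one at which the cycle leaves the \<open>i\<close>th
  element. Replacing the \<open>d - 1\<close> elements between positions \<open>i\<close> and \<open>i + d\<close> by \<open>e\<close> must not increase the weight by 2.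
\<close>

lemma forward_chain:
  fixes p q :: "nat \<Rightarrow> bool"
  assumes "\<And>i d. d \<in> {1, 2, 3} \<Longrightarrow> of_bool (q i) + of_bool (q (i + d)) + of_bool (p i \<noteq> p (i + d)) \<noteq> d"
  shows "\<not> q i" "p (Suc i) = p i"
proof -
  note w = assms[of 1, simplified] assms[of 2, simplified] assms[of 3, simplified]
  \<comment> \<open>If \<open>q\<close> stopped at \<open>i\<close>, then \<open>d = 1\<close> would
    determine the changes of \<open>p\<close> up to \<open>i + 2\<close>, in either case against
    \<open>d = 2\<close>.\<close>
  have step: "q (Suc i)" if "q i" for i
    using that w(1)[of i] w(1)[of "Suc i"] w(2)[of i] by (auto simp: numeral_2_eq_2 of_bool_def split: if_splits)
  show nq: "\<not> q i" for i
  proof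
    assume "q i"
    then have "q i" "q (i + 1)" "q (i + 2)" "q (i + 3)" "q (i + 4)" using step by (auto simp: numeral_eq_Suc)
    \<comment> \<open>Now \<open>d = 2\<close> makes \<open>p\<close> differ at distance 2 and
      \<open>d = 3\<close> makes it agree at distance 3, which is impossible on five
      positions.\<close>
    then show False
      using w(2)[of i] w(2)[of "i + 1"] w(2)[of "i + 2"] w(3)[of i] w(3)[of "i + 1"]
      by (auto simp: numeral_eq_Suc)
  qed
  show "p (Suc i) = p i" using w(1)[of i] nq[of i] nq[of "Suc i"] by (auto simp: of_bool_def split: if_splits)
qed

lemma reversal_chain:
  fixes p q :: "nat \<Rightarrow> bool"
  assumes w: "\<And>i d. d \<in> {1, 2, 3} \<Longrightarrow> i + d \<le> m \<Longrightarrow>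
      of_bool (q i) + of_bool (q (i + d)) + of_bool (p i \<noteq> p (i + d)) \<noteq> d"
    and "\<not> q 0" "q 1" "\<not> q m" "4 \<le> m" "even m"
  shows False
proof -
  have c: "of_bool (q i) + of_bool (q j) + of_bool (p i \<noteq> p j) \<noteq> j - i"
    if "i < j" "j \<le> i + 3" "j \<le> m" for i j
    using w[of "j - i" i] that by auto
  \<comment> \<open>The values at 0 to 4 are forced in turn: \<open>q\<close> fails only at 0, and
    \<open>p\<close> differs from \<open>p 0\<close> exactly at 1 and 4.\<close>
  have p1: "p 1 \<noteq> p 0" using c[of 0 1] assms(2,3,5) by (auto simp: of_bool_def split: if_splits)
  have q2: "q 2"
    using c[of 1 2] c[of 1 3] c[of 2 3] assms(3,5) by (auto simp: of_bool_def split: if_splits)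
  have p2: "p 2 = p 0" using c[of 0 2] q2 assms(2,5) by (auto simp: of_bool_def split: if_splits)
  have q3: "q 3"
    using c[of 2 3] c[of 2 4] c[of 3 4] q2 assms(5) by (auto simp: of_bool_def split: if_splits)
  have p3: "p 3 = p 0" using c[of 1 3] q3 p1 assms(3,5) by (auto simp: of_bool_def split: if_splits)
  have q4: "q 4"
    using c[of 3 4] c[of 2 4] q2 q3 p2 p3 assms(5) by (auto simp: of_bool_def split: if_splits)
  have p4: "p 4 \<noteq> p 0" using c[of 2 4] q2 q4 p2 assms(5) by (auto simp: of_bool_def split: if_splits)
  \<comment> \<open>Parity is essential: for \<open>m = 5\<close> the forced values extend to a
    consistent pattern.\<close>
  have m: "6 \<le> m" using assms(4-6) q4 by (cases "m = 4"; cases "m = 5") auto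
  have "\<not> q 5"
    using c[of 3 5] c[of 2 5] q2 q3 p2 p3 m by (auto simp: of_bool_def split: if_splits)
  then show False
    using c[of 4 5] c[of 4 6] c[of 5 6] q4 m by (auto simp: of_bool_def split: if_splits)
qed

section \<open>Refutation for cycles with no or one reversing element\<close>

context longest_cycle
begin

text \<open>This compares the cycle with the one in which \<open>e\<close> replaces the
  \<open>d - 1\<close> elements at positions \<open>i + 2\<close> to \<open>i + d\<close>. By
  \<open>d < r\<close> the new cycle has at least three elements.\<close>

lemma longest_window:
  assumes "longest xs" "e \<in> I - set xs" "1 \<le> d" "d < r"
    and X_def: "\<And>i. X i = xs ! (i mod r)"
  shows "turn (X i) (X (i + 1)) e + turn (X (i + 1)) e (X (i + 1 + d)) + turn e (X (i + 1 + d)) (X (i + 2 + d))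
    \<noteq> (\<Sum>j<d + 1. turn (X (i + j)) (X (i + j + 1)) (X (i + j + 2))) + 2"
proof -
  have r: "length xs = r" "3 \<le> r" using assms(1) by (auto simp: longest_def cycle_in_def)
  let ?k = "i + 1"
  let ?ys = "map X [?k + 1..<?k + d]" and ?zs = "map X [?k + d + 1..<?k + r]"
  have "rotate k xs = map X [k..<k + r]" for k
    using r by (intro nth_equalityI) (auto simp: nth_rotate X_def)
  then have "rotate ?k xs = map X [?k..<?k + r]" .
  also have "[?k..<?k + r] = [?k..<?k + d] @ [?k + d..<?k + r]"
    using assms(4) upt_add_eq_append[of ?k "?k + d" "r - d"] by simp
  finally have "rotate ?k xs = map X ([?k..<?k + d] @ [?k + d..<?k + r])" .
  moreover have "[?k..<?k + d] = ?k # [?k + 1..<?k + d]" "[?k + d..<?k + r] = (?k + d) # [?k + d + 1..<?k + r]"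
    using assms(3,4) by (simp_all add: upt_conv_Cons del: upt_Suc)
  ultimately have xs: "rotate ?k xs = X ?k # ?ys @ X (?k + d) # ?zs" by simp
  have L: "longest (X ?k # ?ys @ X (?k + d) # ?zs)"
    using longest_rotate[of "take (?k mod length xs) xs" "drop (?k mod length xs) xs"] assms(1)
    unfolding xs[symmetric] rotate_drop_take by simp
  have per: "X (j + r) = X j" for j by (simp add: X_def)
  have last: "last (X (?k + d) # ?zs) = X i"
  proof (cases "d = r - 1")
    case True
    then show ?thesis using r per[of i] by simp
  next
    case False
    then show ?thesis using assms(4) r per[of i] by (auto simp: last_map)
  qed
  have hd: "hd (?zs @ [X ?k]) = X (?k + d + 1)"
  proof (cases "d = r - 1")
    case True
    then show ?thesis using r per[of ?k] by simp
  next
    case False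
    then have "[?k + d + 1..<?k + r] = (?k + d + 1) # [?k + d + 2..<?k + r]"
      using assms(4) by (simp add: upt_conv_Cons del: upt_Suc)
    then show ?thesis by simp
  qed
  have eset: "e \<notin> set (rotate ?k xs)" using assms(2) by simp
  have "weight (X ?k # [e] @ X (?k + d) # ?zs) \<noteq> l + 2"
    using L eset assms(2,4) r unfolding xs
    by (intro weight_neq) (auto simp: longest_def cycle_in_def)
  moreover have "weight (X ?k # ?ys @ X (?k + d) # ?zs) = l" using L by (simp add: longest_def)
  moreover have "X i # X ?k # ?ys @ [X (?k + d), X (?k + d + 1)] = map X [i..<i + (d + 1) + 2]"
    using assms(3) by (cases "d = 1") (simp_all add: upt_conv_Cons[of i] upt_conv_Cons[of "Suc i"])
  then have "turns (X i # X ?k # ?ys @ [X (?k + d), X (?k + d + 1)])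
      = (\<Sum>j<d + 1. turn (X (i + j)) (X (i + j + 1)) (X (i + j + 2)))"
    by (simp only: turns_map_upt)
  ultimately show ?thesis
    unfolding weight_segment[of "X ?k" _ "X (?k + d)" ?zs] last hd by simp
qed

lemma not_all_straight:
  assumes "longest xs" "l = r" "6 \<le> r" "e \<in> I - set xs" "f \<in> I - set xs" "e \<noteq> f"
  shows False
proof -
  define X where "X = (\<lambda>i. xs ! (i mod r))"
  have r: "length xs = r" "3 \<le> r" using assms(1) by (auto simp: longest_def cycle_in_def)
  have X: "X i = xs ! (i mod r)" for i by (simp add: X_def)
  have per: "X (j + r) = X j" for j by (simp add: X_def)
  have "(\<Sum>i<r. turn (X i) (X (Suc i)) (X (Suc (Suc i)))) = (\<Sum>i<r. 1)"
    using weight_conv_sum[of xs] assms(2) r assms(1)[unfolded longest_def] by (simp add: X_def)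
  from sum_mono_inv[OF this[symmetric]]
  have t1: "turn (X i) (X (Suc i)) (X (Suc (Suc i))) = 1" if "i < r" for i
    using that turn_ge_1 by simp
  have t2: "turn (X i) (X (Suc i)) (X (Suc (Suc i))) = 1" for i
  proof -
    have "X (a + i mod r) = X (a + i)" for a by (simp add: X_def mod_add_right_eq)
    from this[of 0] this[of 1] this[of 2] show ?thesis using t1[of "i mod r"] r(2) by simp
  qed
  have st: "S (X (Suc i)) (X i) = S (X (Suc i)) (X (Suc (Suc i)))" for i
    using t2[of i] by (simp add: turn_def split: if_splits)
  have *: "(S (X (Suc i)) g = S (X (Suc i)) (X (Suc (Suc i)))) \<and> S g (X (Suc i)) = S g (X (Suc (Suc i)))"
    if "g \<in> I - set xs" for g i
  proof -
    define q where "q i = (S (X (Suc i)) g \<noteq> S (X (Suc i)) (X (Suc (Suc i))))" for i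
    define p where "p i = S g (X (Suc i))" for i
    have "of_bool (q i) + of_bool (q (i + d)) + of_bool (p i \<noteq> p (i + d)) \<noteq> d"
      if d: "d \<in> {1, 2, 3}" for i d
    proof -
      have "(\<Sum>j<d + 1. turn (X (i + j)) (X (i + j + 1)) (X (i + j + 2))) = d + 1" using t2 by simp
      moreover have "turn (X i) (X (i + 1)) g = 1 + of_bool (q i)"
        "turn g (X (i + 1 + d)) (X (i + 2 + d)) = 1 + of_bool (q (i + d))"
        "turn (X (i + 1)) g (X (i + 1 + d)) = 1 + of_bool (p i \<noteq> p (i + d))"
        using st[of i] by (auto simp: q_def p_def turn_def)
      moreover have "1 \<le> d" "d < r" using d assms(3) by auto
      ultimately show ?thesis
        using longest_window[OF assms(1) \<open>g \<in> I - set xs\<close> _ _ X, of d i] by simp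
    qed
    from forward_chain[of q p, OF this] show ?thesis by (simp add: q_def p_def)
  qed
  obtain b n y zs where xs: "xs = b # n # y # zs"
    using r by (metis Suc_le_length_iff numeral_3_eq_3)
  define w v where "w = last (y # zs)" and "v = hd (zs @ [b])"
  note seg = weight_segment[of b _ y zs, folded w_def v_def]
  have r': "r = length zs + 3" "zs \<noteq> []" using xs r assms(3) by auto
  have X': "X 0 = b" "X 1 = n" "X 2 = y" "X r = b" "X (r - 1) = w" "X 3 = v"
    using r' by (auto simp: X_def xs w_def v_def last_conv_nth hd_conv_nth nth_append mod_Suc)
  then have X1: "X (Suc r) = n" using per[of 1] by simp
  have r1: "Suc (r - Suc 0) = r" using r(2) by simp
  \<comment> \<open>With \<open>e\<close> and \<open>f\<close> on the two sides of \<open>n\<close>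
    every turn here is still 1, so the weight would grow by 2.\<close>
  have "weight (b # [e, n, f] @ y # zs) \<noteq> l + 2"
    using assms(1,4-6) by (intro weight_neq) (auto simp: longest_def cycle_in_def xs)
  moreover have "weight (b # [n] @ y # zs) = l" using assms(1) by (simp add: longest_def xs)
  moreover note X'' = X'[unfolded numeral_2_eq_2 numeral_3_eq_3 One_nat_def] X1
  have "S n b = S n y" "S y n = S y v" "S b w = S b n"
    using st[of 0] st[of 1] st[of "r - 1"] unfolding r1 X'' One_nat_def by auto
  moreover have "S b e = S b n" "S e b = S e n" "S n f = S n y" "S f n = S f y" "S n e = S n y" "S y f = S y v"
    using *[OF assms(4), of "r - 1"] *[OF assms(4), of 0] *[OF assms(5), of 0] *[OF assms(5), of 1]
    unfolding r1 X'' One_nat_def by auto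
  ultimately show False
    unfolding seg
    unfolding append.simps turns.simps turn_def by simp
qed

lemma not_one_reversal:
  assumes "longest (b # n # zs @ [p])" "even l" "6 \<le> l"
    and ef: "e \<in> I - set (b # n # zs @ [p])" "f \<in> I - set (b # n # zs @ [p])" "e \<noteq> f"
    and b: "S b p \<noteq> S b n" "S b e = S b p" "S b f = S b p"
  shows False
proof -
  have lr: "l = r + 1" using weight_one_reversal[OF assms(1) ef b] .
  have L: "longest (p # b # n # zs)" using longest_rotate[of "b # n # zs" "[p]"] assms(1) by simp
  have pe: "S p (last (n # zs)) = S p b" "S p e \<noteq> S p b" "S n e = S n b"
    using same_state[OF L _ _ ef(3) b] ef by auto
  \<comment> \<open>The cycle is read from \<open>b\<close> towards \<open>p\<close>, so that for
    the \<open>q\<close> below \<open>\<not> q 0\<close>, \<open>q 1\<close> and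
    \<open>\<not> q (r - 1)\<close> follow from \<open>b\<close> and \<open>pe\<close>.\<close>
  define xs where "xs = b # p # rev zs @ [n]"
  have xs: "longest xs" using longest_rotate1[OF longest_flip[OF L]] by (simp add: xs_def)
  have e: "e \<in> I - set xs" using ef by (auto simp: xs_def)
  have r: "length xs = r" "5 \<le> r" using xs[unfolded longest_def] lr assms(3) by auto
  define X where "X = (\<lambda>i. xs ! (i mod r))"
  have Xi: "X i = xs ! (i mod r)" for i by (simp add: X_def)
  have per: "X (j + r) = X j" for j by (simp add: X_def)
  have r': "r = length zs + 3" using r(1) by (simp add: xs_def)
  have X: "X 0 = b" "X 1 = p" "X 2 = last (n # zs)" "X (r - 1) = n"
    using r' by (auto simp: X_def xs_def nth_append rev_nth last_conv_nth)
  have st: "S (X (Suc i)) (X i) = S (X (Suc i)) (X (Suc (Suc i)))" if "i < r - 1" for i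
  proof -
    let ?t = "\<lambda>i. turn (X i) (X (Suc i)) (X (Suc (Suc i)))"
    have "X r = b" "X (Suc r) = p" using per[of 0] per[of 1] X by auto
    then have "?t (r - 1) = 2" using r(2) b X(4) by (auto simp: turn_def)
    moreover have "(\<Sum>i<r. ?t i) = r + 1"
      using weight_conv_sum[of xs] r lr xs[unfolded longest_def] by (simp add: X_def)
    moreover have "{..<r} = insert (r - 1) {..<r - 1}" using r(2) by auto
    ultimately have "(\<Sum>i<r - 1. ?t i) = (\<Sum>i<r - 1. 1)" using r(2) by simp
    from sum_mono_inv[OF this[symmetric]] have "?t i = 1" using that turn_ge_1 by simp
    then show ?thesis by (simp add: turn_def split: if_splits)
  qed
  define q where "q i = (S (X i) e \<noteq> S (X i) (X (Suc i)))" for i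
  define u where "u i = S e (X i)" for i
  have "of_bool (q i) + of_bool (q (i + d)) + of_bool (u i \<noteq> u (i + d)) \<noteq> d"
    if d: "d \<in> {1, 2, 3}" and m: "i + d \<le> r - 1" for i d
  proof -
    \<comment> \<open>The predecessor of position \<open>i\<close>, shifted by a full period to
      allow \<open>i = 0\<close>.\<close>
    let ?i = "i + r - 1"
    have d': "1 \<le> d" "d < r" using d r by auto
    let ?t = "\<lambda>j. turn (X (?i + j)) (X (?i + j + 1)) (X (?i + j + 2))"
    have eq: "X (?i + 1) = X i" "X (?i + 1 + d) = X (i + d)" "X (?i + 2 + d) = X (i + d + 1)"
      using per[of i] per[of "i + d"] per[of "i + d + 1"] r(2) by (simp_all add: add_ac)
    have t: "?t j = 1 + of_bool (i + j = 0)" if "j \<le> d" for j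
    proof (cases "i + j = 0")
      case True
      then show ?thesis using X b r(2) per[of 0] per[of 1] by (simp add: turn_def)
    next
      case False
      then obtain k where k: "i + j = Suc k" by (cases "i + j") auto
      have "?i + j = k + r" "?i + j + 1 = Suc k + r" "?i + j + 2 = Suc (Suc k) + r"
        using k r(2) by auto
      then have "?t j = turn (X k) (X (Suc k)) (X (Suc (Suc k)))" by (simp only: per)
      moreover have "k < r - 1" using k m that r(2) by simp
      ultimately show ?thesis using st[of k] False by (simp add: turn_def)
    qed
    \<comment> \<open>The turn at \<open>b\<close> is involved only for \<open>i = 0\<close>; its
      surplus of 1 persists after the replacement and cancels.\<close>
    have "(\<Sum>j<d + 1. ?t j) = (\<Sum>j<Suc d. 1 + of_bool (i + j = 0))" using t by (intro sum.cong) auto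
    also have "\<dots> = d + 1 + of_bool (i = 0)"
      unfolding sum.distrib sum.lessThan_Suc_shift by simp
    finally have "(\<Sum>j<d + 1. ?t j) = d + 1 + of_bool (i = 0)" .
    moreover have "turn (X ?i) (X (?i + 1)) e = 1 + of_bool (q i) + of_bool (i = 0)"
    proof (cases i)
      case 0
      then show ?thesis unfolding eq using X b r(2) by (auto simp: turn_def q_def)
    next
      case (Suc k)
      then have "X ?i = X k" using per[of k] by simp
      then show ?thesis unfolding eq using Suc st[of k] m d' by (auto simp: turn_def q_def)
    qed
    moreover have "turn e (X (?i + 1 + d)) (X (?i + 2 + d)) = 1 + of_bool (q (i + d))"
      "turn (X (?i + 1)) e (X (?i + 1 + d)) = 1 + of_bool (u i \<noteq> u (i + d))"
      unfolding eq by (auto simp: q_def u_def turn_def)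
    ultimately show ?thesis
      using longest_window[OF xs e d' Xi, of ?i] by simp
  qed
  moreover have "\<not> q 0" using X b by (simp add: q_def)
  moreover have "q 1" using X pe by (simp add: q_def numeral_2_eq_2)
  moreover have "\<not> q (r - 1)" using X pe per[of 0] r(2) by (simp add: q_def)
  moreover have "4 \<le> r - 1" "even (r - 1)" using lr assms(2) r(2) by auto
  ultimately show False by (rule reversal_chain)
qed

end

section \<open>The base case and the induction on \<open>k\<close>\<close>

lemma bool_pigeonhole:
  fixes g :: "'a \<Rightarrow> bool"
  assumes "finite A" "2 * m \<le> card A + 1"
  obtains B where "B \<subseteq> A" "card B = m" "\<And>x y. x \<in> B \<Longrightarrow> y \<in> B \<Longrightarrow> g x = g y"
proof -
  have "A = {x \<in> A. g x} \<union> {x \<in> A. \<not> g x}" by auto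
  then have "card A = card {x \<in> A. g x} + card {x \<in> A. \<not> g x}"
    using assms(1) by (metis (no_types, lifting) card_Un_disjoint disjoint_iff finite_Un mem_Collect_eq)
  then consider "m \<le> card {x \<in> A. g x}" | "m \<le> card {x \<in> A. \<not> g x}" using assms(2) by linarith
  then show ?thesis
  proof cases
    case 1
    then obtain B where "B \<subseteq> {x \<in> A. g x}" "card B = m" by (meson obtain_subset_with_card_n)
    then show ?thesis by (intro that[of B]) auto
  next
    case 2
    then obtain B where "B \<subseteq> {x \<in> A. \<not> g x}" "card B = m" by (meson obtain_subset_with_card_n)
    then show ?thesis by (intro that[of B]) auto
  qed
qed

context sides
begin

lemma length_le_weight:
  assumes "2 \<le> length xs"
  shows "length xs \<le> weight xs"
proof -
  have "(\<Sum>i<length xs. 1) \<le> weight xs"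
    unfolding weight_conv_sum[OF assms] by (intro sum_mono) (simp add: turn_def)
  then show ?thesis by simp
qed

text \<open>Weight 6 on \<open>n\<close> elements means exactly \<open>6 - n\<close> reversing ones.
  Its negation is spelled out in equalities of ends for propositional reasoning.\<close>

lemma weight_neq_6:
  "weight [a, b, c] \<noteq> 6 \<longleftrightarrow> S a c = S a b \<or> S b a = S b c \<or> S c b = S c a"
  "weight [a, b, c, d] \<noteq> 6 \<longleftrightarrow>
    (let p = (S a d = S a b); q = (S b a = S b c); r = (S c b = S c d); s = (S d c = S d a) in
     (p \<longrightarrow> q \<longrightarrow> r \<or> s) \<and> (p \<longrightarrow> r \<longrightarrow> q \<or> s) \<and> (p \<longrightarrow> s \<longrightarrow> q \<or> r) \<and>
     (q \<longrightarrow> r \<longrightarrow> p \<or> s) \<and> (q \<longrightarrow> s \<longrightarrow> p \<or> r) \<and> (r \<longrightarrow> s \<longrightarrow> p \<or> q))"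
  "weight [a, b, c, d, e] \<noteq> 6 \<longleftrightarrow>
    (let p = (S a e = S a b); q = (S b a = S b c); r = (S c b = S c d); s = (S d c = S d e);
       t = (S e d = S e a) in
     (p \<longrightarrow> q \<longrightarrow> r \<longrightarrow> s \<longrightarrow> t) \<and> (p \<longrightarrow> q \<longrightarrow> r \<longrightarrow> t \<longrightarrow> s) \<and> (p \<longrightarrow> q \<longrightarrow> s \<longrightarrow> t \<longrightarrow> r) \<and>
     (p \<longrightarrow> r \<longrightarrow> s \<longrightarrow> t \<longrightarrow> q) \<and> (q \<longrightarrow> r \<longrightarrow> s \<longrightarrow> t \<longrightarrow> p))"
  "weight [a, b, c, d, e, f] \<noteq> 6 \<longleftrightarrow>
    \<not> (S a f = S a b \<and> S b a = S b c \<and> S c b = S c d \<and> S d c = S d e \<and> S e d = S e f \<and> S f e = S f a)"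
  by (auto simp: weight_def turn_def Let_def numeral_2_eq_2)

lemma weight_6:
  assumes "card I = 6"
  obtains xs where "cycle_in I xs" "weight xs = 6"
proof -
  have "\<exists>xs. cycle_in I xs \<and> weight xs = 6"
  proof (rule ccontr)
    assume H: "\<nexists>xs. cycle_in I xs \<and> weight xs = 6"
    have fin: "finite I" using assms by (simp add: card_ge_0_finite)
    obtain a where a: "a \<in> I" using assms by fastforce
    \<comment> \<open>Three of the five other elements are attached to the same end of
      \<open>a\<close>, which breaks the symmetry before the finite check.\<close>
    obtain B where B: "B \<subseteq> I - {a}" "card B = 3" "\<And>x y. x \<in> B \<Longrightarrow> y \<in> B \<Longrightarrow> S a x = S a y"
      using bool_pigeonhole[of "I - {a}" 3 "S a"] a fin assms by auto
    obtain b c d where bcd: "B = {b, c, d}" "b \<noteq> c" "b \<noteq> d" "c \<noteq> d"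
      using B(2) by (auto simp: card_3_iff)
    have "card (I - {a} - B) = 2" using a fin assms B by (simp add: card_Diff_subset finite_subset)
    then obtain e f where ef: "I - {a} - B = {e, f}" "e \<noteq> f" by (auto simp: card_2_iff)
    have dist: "distinct [a, b, c, d, e, f]" and sub: "{a, b, c, d, e, f} \<subseteq> I"
      using a B(1) bcd ef by auto
    have "weight xs \<noteq> 6" if "distinct xs" "set xs \<subseteq> {a, b, c, d, e, f}" "3 \<le> length xs" for xs
      using H that sub unfolding cycle_in_def by blast
    \<comment> \<open>an unsatisfiable subset, found with a SAT solver, of the constraints from all cycles\<close>
    then have "weight [a, b, f] \<noteq> 6" "weight [b, c, e] \<noteq> 6" "weight [c, d, e] \<noteq> 6"
    "weight [a, b, d, c] \<noteq> 6" "weight [a, c, e, d] \<noteq> 6" "weight [b, c, d, e] \<noteq> 6"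
    "weight [a, b, c, d] \<noteq> 6" "weight [a, b, c, f] \<noteq> 6" "weight [b, e, c, f] \<noteq> 6"
    "weight [a, b, e, c] \<noteq> 6" "weight [b, c, d, f] \<noteq> 6" "weight [a, b, e, d] \<noteq> 6"
    "weight [a, d, b, f] \<noteq> 6" "weight [a, b, e, c, d] \<noteq> 6" "weight [a, b, c, f, d] \<noteq> 6"
    "weight [b, e, d, c, f] \<noteq> 6" "weight [a, b, c, e, d] \<noteq> 6"
    "weight [a, c, b, f, d] \<noteq> 6" "weight [a, b, f, c, d] \<noteq> 6"
    "weight [a, b, d, e, c] \<noteq> 6" "weight [a, c, e, b, f] \<noteq> 6"
    "weight [a, c, e, d, f] \<noteq> 6" "weight [a, b, d, e, c, f] \<noteq> 6"
      using dist by auto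
    moreover have "S a b = S a c" "S a c = S a d" using B(3) bcd by auto
    ultimately show False unfolding weight_neq_6 Let_def by argo
  qed
  then show ?thesis using that by blast
qed

lemma extend_weight:
  assumes "card I = l + 2" "even l" "6 \<le> l" "cycle_in I xs" "weight xs = l"
  shows "\<exists>ys. cycle_in I ys \<and> weight ys = l + 2"
proof (rule ccontr)
  assume none: "\<nexists>ys. cycle_in I ys \<and> weight ys = l + 2"
  have fin: "finite I" using assms(1) by (simp add: card_ge_0_finite)
  let ?P = "\<lambda>n. \<exists>ys. cycle_in I ys \<and> weight ys = l \<and> length ys = n"
  \<comment> \<open>A cycle of weight \<open>l\<close> has at most \<open>l\<close> elements, so a
    greatest length exists.\<close>
  define r where "r = (GREATEST n. ?P n)"
  have bound: "n \<le> l" if "?P n" for n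
    using that length_le_weight by (fastforce simp: cycle_in_def)
  have ex: "?P (length xs)" using assms(4,5) by blast
  have "?P r" unfolding r_def by (rule GreatestI_nat[of ?P, OF ex bound])
  then obtain ys where ys: "cycle_in I ys" "weight ys = l" "length ys = r" by blast
  have r: "r \<le> l" "3 \<le> r" using bound[OF \<open>?P r\<close>] ys by (auto simp: cycle_in_def)
  interpret longest_cycle S I l r
  proof
    show "length xs \<le> r" if "cycle_in I xs" "weight xs = l" for xs
      unfolding r_def using that by (intro Greatest_le_nat[of ?P _ l] bound) auto
  qed (use none in blast)
  have L: "longest ys" using ys by (simp add: longest_def)
  have left: "card (I - set ys) = l + 2 - r"
    using assms(1) ys fin by (simp add: cycle_in_def card_Diff_subset distinct_card)
  show False
  proof (cases "r = l")
    case True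
    then have "card (I - set ys) = 2" using left by simp
    then obtain e f where "I - set ys = {e, f}" "e \<noteq> f" by (auto simp: card_2_iff)
    then show False using not_all_straight[OF L, of e f] True assms(3) by auto
  next
    case False
    define x where "x = (\<lambda>i. ys ! (i mod length ys))"
    have "\<exists>i<r. turn (x i) (x (Suc i)) (x (Suc (Suc i))) \<noteq> 1"
    proof (rule ccontr)
      assume "\<not> ?thesis"
      then have "weight ys = r" using weight_conv_sum[of ys] ys(3) r by (simp add: x_def)
      then show False using ys(2) False by simp
    qed
    then obtain i where i: "turn (x i) (x (Suc i)) (x (Suc (Suc i))) \<noteq> 1" by blast
    obtain p b n zs where rot: "rotate i ys = p # b # n # zs"
      using r ys(3) by (metis Suc_le_length_iff length_rotate numeral_3_eq_3)
    have "x i = p" "x (Suc i) = b" "x (Suc (Suc i)) = n"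
      using nth_rotate[of 0 ys i] nth_rotate[of 1 ys i] nth_rotate[of 2 ys i] r ys(3)
      by (simp_all add: rot x_def)
    then have b: "S b p \<noteq> S b n" using i by (simp add: turn_def split: if_splits)
    have P: "longest (p # b # n # zs)"
      using longest_rotate[of "take (i mod length ys) ys" "drop (i mod length ys) ys"] L
      unfolding rot[symmetric] rotate_drop_take by simp
    have "set (p # b # n # zs) = set ys" using rot by (metis set_rotate)
    moreover have "2 * 2 \<le> card (I - set ys) + 1" using left False r by linarith
    then obtain B where B: "B \<subseteq> I - set ys" "card B = 2"
      "\<And>x y. x \<in> B \<Longrightarrow> y \<in> B \<Longrightarrow> S b x = S b y"
      using bool_pigeonhole[of "I - set ys" 2 "S b"] fin by (metis finite_Diff)
    moreover obtain e f where "B = {e, f}" "e \<noteq> f" using B(2) by (auto simp: card_2_iff)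
    ultimately have ef: "e \<in> I - set (p # b # n # zs)" "f \<in> I - set (p # b # n # zs)" "e \<noteq> f" "S b e = S b f"
      by auto
    show False
    proof (cases "S b e = S b p")
      case True
      have "longest (b # n # zs @ [p])" using longest_rotate1[OF P] by simp
      then show False using not_one_reversal[of b n zs p e f] assms(2,3) ef b True by auto
    next
      case False
      \<comment> \<open>Here \<open>e\<close> and \<open>f\<close> are attached on the side of
        \<open>n\<close>; reading the cycle backwards exchanges \<open>p\<close> and
        \<open>n\<close>.\<close>
      have "longest (b # p # rev zs @ [n])" using longest_rotate1[OF longest_flip[OF P]] by simp
      then show False using not_one_reversal[of b p "rev zs" n e f] assms(2,3) ef b False by auto
    qed
  qed
qed

theorem ex_even_weight:
  assumes "finite I" "card I = 2 * k" "3 \<le> k"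
  shows "\<exists>xs. cycle_in I xs \<and> weight xs = 2 * k"
  using assms(3,1,2)
proof (induction k arbitrary: I rule: dec_induct)
  case base
  then show ?case using weight_6[of I] by auto
next
  case (step k)
  obtain J where J: "J \<subseteq> I" "card J = 2 * k"
    using obtain_subset_with_card_n[of "2 * k" I] step.prems(2) by auto
  moreover have "finite J" using J(1) step.prems(1) by (rule finite_subset)
  ultimately obtain xs where "cycle_in J xs" "weight xs = 2 * k" using step.IH by blast
  then have "cycle_in I xs" using J(1) by (auto simp: cycle_in_def)
  then show ?case using extend_weight[of I "2 * k" xs] step \<open>weight xs = 2 * k\<close> by simp
qed

end

section \<open>From weighted cycles to cycles of the graph\<close>

lemma not_graph_free_cycle:
  assumes "simple_graph G" "distinct vs" "vs \<noteq> []"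
    and "successively (\<lambda>u v. {u, v} \<in> edges G) vs" "{last vs, hd vs} \<in> edges G"
  shows "\<not> graph_free (cycle_graph (length vs)) G"
proof -
  let ?n = "length vs"
  define H where "H = (set vs, {{vs ! i, vs ! (Suc i mod ?n)} | i. i < ?n})"
  have edge: "{vs ! i, vs ! (Suc i mod ?n)} \<in> edges G" if "i < ?n" for i
  proof (cases "Suc i = ?n")
    case True
    then have "last vs = vs ! i" using last_conv_nth[OF assms(3)] by (metis diff_Suc_1)
    then show ?thesis using assms(3,5) True by (simp add: hd_conv_nth)
  next
    case False
    then show ?thesis using assms(4) that by (auto simp: successively_conv_nth)
  qed
  then have eH: "edges H \<subseteq> edges G" by (auto simp: H_def)
  have sub: "e \<subseteq> set vs" if "e \<in> edges H" for e
    using that assms(3) by (auto simp: H_def)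
  have "set vs \<subseteq> verts G"
  proof
    fix v assume "v \<in> set vs"
    then obtain i where "i < ?n" "v = vs ! i" by (auto simp: in_set_conv_nth)
    then show "v \<in> verts G" using edge[of i] assms(1) by (auto simp: simple_graph_def)
  qed
  moreover have vH: "verts H = set vs" by (simp add: H_def)
  moreover have "card e = 2" if "e \<in> edges H" for e
    using that eH assms(1) unfolding simple_graph_def by blast
  ultimately have "subgraph H G"
    using sub eH unfolding subgraph_def simple_graph_def vH by blast
  moreover have "isomorphic (cycle_graph ?n) H"
    unfolding isomorphic_def
  proof (intro exI conjI)
    show "bij_betw ((!) vs) (verts (cycle_graph ?n)) (verts H)"
      using assms(2) by (simp add: cycle_graph_def H_def bij_betw_nth)
    show "edges H = (\<lambda>e. (!) vs ` e) ` edges (cycle_graph ?n)"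
      by (simp add: cycle_graph_def H_def setcompr_eq_image image_image)
  qed
  ultimately show ?thesis unfolding graph_free_def by blast
qed

locale sided_matching = sides S for S :: "'a set \<Rightarrow> 'a set \<Rightarrow> bool" +
  fixes G :: "'a ugraph" and M :: "'a set set" and end_of :: "'a set \<Rightarrow> bool \<Rightarrow> 'a"
  assumes edges: "M \<subseteq> edges G"
    and ends: "e \<in> M \<Longrightarrow> {end_of e True, end_of e False} = e"
    and ends_neq: "e \<in> M \<Longrightarrow> end_of e True \<noteq> end_of e False"
    and disjoint: "e \<in> M \<Longrightarrow> f \<in> M \<Longrightarrow> e \<noteq> f \<Longrightarrow> e \<inter> f = {}"
    and joined: "e \<in> M \<Longrightarrow> f \<in> M \<Longrightarrow> e \<noteq> f \<Longrightarrow> {end_of e (S e f), end_of f (S f e)} \<in> edges G"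
begin

text \<open>The first and the last element contribute no vertex and only serve as neighbours, as in
  \<open>turns\<close>.\<close>

fun tour :: "'a set list \<Rightarrow> 'a list" where
  "tour (e # f # g # xs) =
    (if S f e = S f g then [end_of f (S f e)] else [end_of f (S f e), end_of f (S f g)]) @ tour (f # g # xs)"
| "tour _ = []"

lemma end_of_in: "e \<in> M \<Longrightarrow> end_of e s \<in> e"
  using equalityD1[OF ends[of e]] by (cases s) auto

lemma length_tour: "length (tour xs) = turns xs"
  by (induction xs rule: tour.induct) (auto simp: turn_def)

lemma set_tour: "set xs \<subseteq> M \<Longrightarrow> set (tour xs) \<subseteq> \<Union> (set (butlast (tl xs)))"
proof (induction xs rule: tour.induct)
  case (1 e f g xs)
  have "butlast (tl (e # f # g # xs)) = f # butlast (g # xs)" by simp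
  moreover have "set (tour (f # g # xs)) \<subseteq> \<Union> (set (butlast (g # xs)))" using 1 by simp
  ultimately show ?case using end_of_in[of f] "1.prems" by (auto simp del: butlast.simps)
qed auto

lemma distinct_tour:
  assumes "set xs \<subseteq> M" "distinct (butlast (tl xs))"
  shows "distinct (tour xs)"
  using assms
proof (induction xs rule: tour.induct)
  case (1 e f g xs)
  have "butlast (tl (e # f # g # xs)) = f # butlast (g # xs)" by simp
  then have "f \<notin> set (butlast (g # xs))" using "1.prems"(2) by (simp del: butlast.simps)
  moreover have "set (butlast (g # xs)) \<subseteq> M"
    using "1.prems"(1) in_set_butlastD[of _ "g # xs"] by fastforce
  ultimately have "f \<inter> \<Union> (set (butlast (g # xs))) = {}" using disjoint[of f] "1.prems"(1) by fastforce
  moreover have "set (tour (f # g # xs)) \<subseteq> \<Union> (set (butlast (g # xs)))"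
    using set_tour[of "f # g # xs"] "1.prems" by simp
  moreover have "end_of f s \<in> f" for s using end_of_in "1.prems" by simp
  ultimately have "end_of f s \<notin> set (tour (f # g # xs))" for s by blast
  moreover have "distinct (tour (f # g # xs))" using "1.IH" "1.prems" by (simp split: if_splits)
  moreover have "S f e \<noteq> S f g \<Longrightarrow> end_of f (S f e) \<noteq> end_of f (S f g)"
    using ends_neq[of f] "1.prems"(1) by (cases "S f e"; cases "S f g") auto
  ultimately show ?case by auto
qed auto

lemma hd_tour: "tour (e # f # g # xs) \<noteq> []" "hd (tour (e # f # g # xs)) = end_of f (S f e)"
  by auto

lemma last_tour: "last (tour (xs @ [e, f, g])) = end_of f (S f g)"
proof (induction xs)
  case (Cons x xs)
  have "tour (xs @ [e, f, g]) \<noteq> []" by (cases "xs @ [e, f, g]" rule: tour.cases) auto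
  then have "last (tour (x # xs @ [e, f, g])) = last (tour (xs @ [e, f, g]))"
    by (cases "xs @ [e, f, g]" rule: tour.cases) auto
  then show ?case using Cons by simp
qed auto

lemma successively_tour:
  assumes "successively (\<lambda>e f. e \<in> M \<and> f \<in> M \<and> e \<noteq> f) xs"
  shows "successively (\<lambda>u v. {u, v} \<in> edges G) (tour xs)"
  using assms
proof (induction xs rule: tour.induct)
  case (1 e f g xs)
  have f: "{end_of f s, end_of f t} \<in> edges G" if "s \<noteq> t" for s t
  proof -
    have "{end_of f s, end_of f t} = f"
      using ends[of f] "1.prems" that by (cases s; cases t) (auto simp: insert_commute)
    then show ?thesis using edges "1.prems" by auto
  qed
  have "successively (\<lambda>u v. {u, v} \<in> edges G) (tour (f # g # xs))" using 1 by simp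
  moreover have "{end_of f (S f g), hd (tour (f # g # xs))} \<in> edges G" if "tour (f # g # xs) \<noteq> []"
    using joined[of f g] "1.prems" that by (cases xs) auto
  moreover have "S f e \<noteq> S f g \<Longrightarrow> {end_of f (S f e), end_of f (S f g)} \<in> edges G" by (rule f)
  ultimately show ?case by (auto simp: successively_append_iff)
qed auto

lemma cycle_of_weight:
  assumes "simple_graph G" "cycle_in M xs"
  shows "\<not> graph_free (cycle_graph (weight xs)) G"
proof -
  obtain x y z zs where xs: "xs = x # y # z # zs"
    using assms(2) by (metis Suc_le_length_iff numeral_3_eq_3 cycle_in_def)
  \<comment> \<open>With two elements repeated, the tour starts in \<open>y\<close>, ends in
    \<open>x\<close> and visits each element once.\<close>
  define ws where "ws = xs @ [x, y]"
  have dist: "distinct xs" and M: "set xs \<subseteq> M" using assms(2) by (auto simp: cycle_in_def)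
  have "successively (\<lambda>e f. e \<in> M \<and> f \<in> M \<and> e \<noteq> f) xs"
    using dist M by (auto simp: successively_conv_nth distinct_conv_nth) 
  moreover have "last xs \<in> set (y # z # zs)"
    using last_in_set[of "y # z # zs"] by (simp only: xs last_ConsR) simp
  then have "last xs \<in> M" "last xs \<noteq> x" using dist M unfolding xs by auto
  moreover have "x \<in> M" "y \<in> M" "x \<noteq> y" using dist M by (auto simp: xs)
  ultimately have "successively (\<lambda>e f. e \<in> M \<and> f \<in> M \<and> e \<noteq> f) ws"
    unfolding ws_def successively_append_iff by simp
  then have "successively (\<lambda>u v. {u, v} \<in> edges G) (tour ws)" by (rule successively_tour)
  moreover have "butlast (tl ws) = y # z # zs @ [x]" by (simp add: ws_def xs butlast_append)
  then have "distinct (tour ws)" using dist M by (intro distinct_tour) (auto simp: ws_def xs)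
  moreover have ws: "tour ws \<noteq> []" "hd (tour ws) = end_of y (S y x)"
    unfolding ws_def xs append_Cons by (rule hd_tour)+
  moreover have "ws = butlast xs @ [last xs, x, y]"
    using append_butlast_last_id[of xs] by (simp add: ws_def xs flip: append_assoc)
  then have "last (tour ws) = end_of x (S x y)" using last_tour by simp
  then have "{last (tour ws), hd (tour ws)} \<in> edges G"
    using joined[of x y] dist M ws by (simp add: xs)
  ultimately have "\<not> graph_free (cycle_graph (length (tour ws))) G"
    using not_graph_free_cycle[OF assms(1)] by blast
  moreover have "length (tour ws) = weight xs"
    unfolding length_tour by (simp add: ws_def weight_def xs numeral_2_eq_2)
  ultimately show ?thesis by metis
qed

end

section \<open>Strong cliques\<close>

lemma strong_clique_joined:
  assumes "simple_graph G" "strong_clique G S" "e \<in> S" "f \<in> S" "e \<inter> f = {}"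
  shows "\<exists>g \<in> edges G. g \<inter> e \<noteq> {} \<and> g \<inter> f \<noteq> {}"
proof (rule ccontr)
  assume none: "\<not> ?thesis"
  have "card e = 2" using assms(1-3) by (auto simp: simple_graph_def strong_clique_def)
  then have ne: "e \<noteq> {}" by auto
  \<comment> \<open>A shorter walk has at most three vertices; as \<open>e\<close> and
    \<open>f\<close> are disjoint it has exactly three, and the middle one joins them.\<close>
  have "3 \<le> length xs - 1" if "walk (line_graph G) xs" "hd xs = e" "last xs = f" for xs
  proof (rule ccontr)
    assume "\<not> 3 \<le> length xs - 1"
    then have "length xs \<le> 3" by simp
    then consider "xs = []" | d where "xs = [d]" | d g where "xs = [d, g]" | d g h where "xs = [d, g, h]"
      by (cases xs; cases "tl xs"; cases "tl (tl xs)") auto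
    then show False
    proof cases
      case 2
      then show False using that assms(5) ne by auto
    next
      case 3
      then show False using that assms(5)
        by (auto simp: walk_def line_graph_def doubleton_eq_iff)
    next
      case 4
      then have "g \<in> edges G" "g \<inter> e \<noteq> {}" "g \<inter> f \<noteq> {}" using that
        by (auto simp: walk_def line_graph_def doubleton_eq_iff)
      then show False using none by blast
    qed (use that in \<open>simp add: walk_def\<close>)
  qed
  then have "3 \<le> edge_distance G e f"
    unfolding edge_distance_def distance_def by (intro INF_greatest) (auto simp: numeral_eq_enat)
  moreover have "edge_distance G e f \<le> 2" using assms(2-4) by (simp add: strong_clique_def)
  ultimately have "(3 :: enat) \<le> 2" by (rule order_trans)
  then show False by simp
qed

lemma strong_clique_matching_less:
  assumes "simple_graph G" "graph_free (cycle_graph (2 * k)) G" "3 \<le> k"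
    and "strong_clique G S" "M \<subseteq> S" "pairwise disjnt M"
  shows "card M < 2 * k"
proof (rule ccontr)
  assume "\<not> card M < 2 * k"
  then obtain N where N: "N \<subseteq> M" "card N = 2 * k" "finite N"
    using obtain_subset_with_card_n[of "2 * k" M] by (metis not_less)
  have NE: "e \<in> edges G" "card e = 2" if "e \<in> N" for e
    using that N(1) assms(1,4,5) by (auto simp: strong_clique_def simple_graph_def)
  have "\<forall>e \<in> N. \<exists>u v. u \<noteq> v \<and> {u, v} = e" using NE by (metis card_2_iff)
  then obtain u v where uv: "\<And>e. e \<in> N \<Longrightarrow> u e \<noteq> v e \<and> {u e, v e} = e" by metis
  have sub: "e \<subseteq> {u e, v e}" if "e \<in> N" for e using uv[OF that] by simp
  \<comment> \<open>Indexing by the unordered pair gives \<open>T e f\<close> and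
    \<open>T f e\<close> the same joining edge.\<close>
  define link where "link D = (SOME g. g \<in> edges G \<and> (\<forall>e \<in> D. g \<inter> e \<noteq> {}))" for D
  define T where "T e f = (u e \<in> link {e, f})" for e f
  define end_of where "end_of e s = (if s then u e else v e)" for e s
  have disj: "e \<inter> f = {}" if "e \<in> N" "f \<in> N" "e \<noteq> f" for e f
    using that N(1) assms(6) by (auto simp: pairwise_def disjnt_def)
  interpret sided_matching T G N end_of
  proof
    fix e f assume ef: "e \<in> N" "f \<in> N" "e \<noteq> f"
    have "\<exists>g. g \<in> edges G \<and> (\<forall>e \<in> {e, f}. g \<inter> e \<noteq> {})"
      using strong_clique_joined[OF assms(1,4), of e f] ef N(1) assms(5) disj by blast
    from someI_ex[OF this]
    have g: "link {e, f} \<in> edges G" "link {e, f} \<inter> e \<noteq> {}" "link {e, f} \<inter> f \<noteq> {}"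
      by (auto simp: link_def)
    have "u e \<in> link {e, f} \<or> v e \<in> link {e, f}" "u f \<in> link {f, e} \<or> v f \<in> link {f, e}"
      using g(2,3) sub[OF ef(1)] sub[OF ef(2)] by (auto simp: insert_commute)
    then have "end_of e (T e f) \<in> link {e, f} \<inter> e" "end_of f (T f e) \<in> link {e, f} \<inter> f"
      using uv[OF ef(1)] uv[OF ef(2)] by (auto simp: end_of_def T_def insert_commute)
    moreover have "card (link {e, f}) = 2" using g(1) assms(1) by (simp add: simple_graph_def)
    \<comment> \<open>The two ends lie in disjoint edges, so they are distinct and exhaust the
      joining edge.\<close>
    ultimately have "{end_of e (T e f), end_of f (T f e)} = link {e, f}"
      using disj[OF ef] by (intro card_subset_eq) (auto simp: card_insert_if card_ge_0_finite)
    then show "{end_of e (T e f), end_of f (T f e)} \<in> edges G" using g(1) by simp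
  qed (use uv NE disj in \<open>auto simp: end_of_def\<close>)
  obtain xs where "cycle_in N xs" "weight xs = 2 * k" using ex_even_weight[of N k] N assms(3) by blast
  then show False using cycle_of_weight[OF assms(1)] assms(2) by metis
qed

section \<open>Counting edges by means of a maximum matching\<close>

lemma degree_le_max_degree: "simple_graph G \<Longrightarrow> v \<in> verts G \<Longrightarrow> degree G v \<le> max_degree G"
  by (simp add: max_degree_def simple_graph_def)

lemma card_le_of_matching_bound:
  assumes G: "simple_graph G" and S: "S \<subseteq> edges G"
    and m: "\<And>M. M \<subseteq> S \<Longrightarrow> pairwise disjnt M \<Longrightarrow> card M \<le> m"
  shows "card S \<le> m * max_degree G + m\<^sup>2"
proof -
  have fin_edges: "finite (edges G)"
    using G by (auto simp: simple_graph_def intro!: finite_subset[of "edges G" "Pow (verts G)"])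
  then have fin: "finite S" using S finite_subset by blast
  have E: "finite e" "card e = 2" "e \<subseteq> verts G" if "e \<in> S" for e
    using that S G by (auto simp: simple_graph_def intro: finite_subset)
  let ?P = "\<lambda>M. M \<subseteq> S \<and> pairwise disjnt M"
  have "?P {}" by simp
  from ex_has_greatest_nat[of ?P, OF this, of card "Suc m"]
  obtain M where M: "M \<subseteq> S" "pairwise disjnt M" and max: "\<And>N. N \<subseteq> S \<Longrightarrow> pairwise disjnt N \<Longrightarrow> card N \<le> card M"
    using m by (metis le_imp_less_Suc)
  have finM: "finite M" using M(1) fin finite_subset by blast
  define U where "U = \<Union> M"
  have meets: "f \<inter> U \<noteq> {}" if "f \<in> S" for f
  proof
    assume fU: "f \<inter> U = {}"
    have "f \<noteq> {}" using E(2)[OF that] by auto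
    then have "f \<notin> M" using fU by (auto simp: U_def)
    moreover have "pairwise disjnt (insert f M)"
      using M(2) fU by (auto simp: U_def pairwise_insert disjnt_def)
    ultimately show False using max[of "insert f M"] M(1) that finM by simp
  qed
  define out where "out v = {x. {v, x} \<in> S \<and> x \<notin> U}" for v
  have out_verts: "out v \<subseteq> verts G" for v using E(3) by (auto simp: out_def)
  have fin_out: "finite (out v)" for v
    using G by (intro finite_subset[OF out_verts]) (simp add: simple_graph_def)
  \<comment> \<open>If both ends had two neighbours outside \<open>U\<close>, distinct ones could be
    chosen, and replacing \<open>e\<close> by the two resulting edges would enlarge the
    matching.\<close>
  have "\<exists>a b. e = {a, b} \<and> card (out b) \<le> 1" if e: "e \<in> M" for e
  proof (rule ccontr)
    assume none: "\<not> ?thesis"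
    obtain a b where ab: "e = {a, b}" "a \<noteq> b" using E(2)[of e] e M(1) by (auto simp: card_2_iff)
    have "e = {b, a}" using ab(1) by (simp add: insert_commute)
    then have "\<not> card (out a) \<le> 1" "\<not> card (out b) \<le> 1" using none ab(1) by blast+
    then have big: "2 \<le> card (out a)" "2 \<le> card (out b)" by auto
    obtain x where x: "x \<in> out a" using big(1) by fastforce
    have "\<not> out b \<subseteq> {x}" using big(2) card_mono[of "{x}" "out b"] by auto
    then obtain y where y: "y \<in> out b" "y \<noteq> x" by blast
    define N where "N = M - {e}"
    have N: "finite N" "card M = Suc (card N)" "N \<subseteq> M" "pairwise disjnt N"
      using finM e M(2) card_Suc_Diff1[OF finM e] by (auto simp: N_def intro: pairwise_subset)
    have U: "a \<in> U" "b \<in> U" "x \<notin> U" "y \<notin> U" using ab e x y by (auto simp: U_def out_def)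
    have ab': "a \<notin> f" "b \<notin> f" if "f \<in> N" for f
    proof -
      have "disjnt e f" using that e M(2) by (auto simp: N_def pairwise_def)
      then show "a \<notin> f" "b \<notin> f" using ab(1) by (auto simp: disjnt_def)
    qed
    have xy': "x \<notin> f" "y \<notin> f" if "f \<in> N" for f using that N(3) U by (auto simp: U_def)
    have "{a, x} \<noteq> {b, y}" "{a, x} \<notin> N" "{b, y} \<notin> N"
      using ab(2) y U ab' by (auto simp: doubleton_eq_iff)
    then have "card (insert {a, x} (insert {b, y} N)) = card M + 1" using N by simp
    moreover have "pairwise disjnt (insert {a, x} (insert {b, y} N))"
      using N(4) ab(2) y(2) U ab' xy' by (auto simp: pairwise_insert disjnt_def)
    moreover have "insert {a, x} (insert {b, y} N) \<subseteq> S" using M(1) N(3) x y by (auto simp: out_def)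
    ultimately show False using max[of "insert {a, x} (insert {b, y} N)"] by simp
  qed
  then obtain a b where e_ab: "\<And>e. e \<in> M \<Longrightarrow> e = {a e, b e}"
    and out_b: "\<And>e. e \<in> M \<Longrightarrow> card (out (b e)) \<le> 1" by metis
  have ab: "a e \<in> e" "e \<subseteq> {a e, b e}" if "e \<in> M" for e using e_ab[OF that] by blast+
  define A where "A = a ` M"
  \<comment> \<open>Edges at some \<open>a e\<close> give the degree term. The others give the
    square: from \<open>b e\<close> they lead to some other \<open>b e'\<close> or, at most once,
    out of \<open>U\<close>.\<close>
  let ?SA = "\<lambda>e. {f \<in> S. a e \<in> f}" and ?SB = "\<lambda>e. {f \<in> S. b e \<in> f \<and> f \<inter> A = {}}"
  have "S \<subseteq> (\<Union>e\<in>M. ?SA e) \<union> (\<Union>e\<in>M. ?SB e)"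
  proof
    fix f assume f: "f \<in> S"
    then obtain z e where "z \<in> f" "e \<in> M" "z \<in> e" using meets[of f] by (auto simp: U_def)
    then have "e \<in> M" "a e \<in> f \<or> b e \<in> f" using ab(2)[of e] by auto
    then show "f \<in> (\<Union>e\<in>M. ?SA e) \<union> (\<Union>e\<in>M. ?SB e)" using f by (auto simp: A_def)
  qed
  then have "card S \<le> card ((\<Union>e\<in>M. ?SA e) \<union> (\<Union>e\<in>M. ?SB e))"
    using fin finM by (intro card_mono) auto
  also have "\<dots> \<le> (\<Sum>e\<in>M. card (?SA e)) + (\<Sum>e\<in>M. card (?SB e))"
    using card_Un_le[of "\<Union>e\<in>M. ?SA e" "\<Union>e\<in>M. ?SB e"] card_UN_le[OF finM, of ?SA]
      card_UN_le[OF finM, of ?SB] by linarith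
  also have "(\<Sum>e\<in>M. card (?SA e)) \<le> (\<Sum>e\<in>M. max_degree G)"
  proof (rule sum_mono)
    fix e assume e: "e \<in> M"
    then have "a e \<in> verts G" using ab(1)[OF e] E(3)[of e] M(1) by blast
    then have "degree G (a e) \<le> max_degree G" using degree_le_max_degree[OF G] by blast
    moreover have "card (?SA e) \<le> degree G (a e)"
      unfolding degree_def using S fin_edges by (intro card_mono) auto
    ultimately show "card (?SA e) \<le> max_degree G" by simp
  qed
  also have "(\<Sum>e\<in>M. card (?SB e)) \<le> (\<Sum>e\<in>M. card M)"
  proof (rule sum_mono)
    fix e assume e: "e \<in> M"
    have "?SB e \<subseteq> (\<lambda>e'. {b e, b e'}) ` (M - {e}) \<union> (\<lambda>x. {b e, x}) ` out (b e)"
    proof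
      fix f assume "f \<in> ?SB e"
      then have f: "f \<in> S" "b e \<in> f" "f \<inter> A = {}" by auto
      then obtain x where x: "f = {b e, x}" "x \<noteq> b e" using E(2)[of f] by (auto simp: card_2_iff)
      show "f \<in> (\<lambda>e'. {b e, b e'}) ` (M - {e}) \<union> (\<lambda>x. {b e, x}) ` out (b e)"
      proof (cases "x \<in> U")
        case True
        then obtain e' where e': "e' \<in> M" "x \<in> e'" by (auto simp: U_def)
        then have "x = a e' \<or> x = b e'" using ab(2)[of e'] by blast
        then have "x = b e'" using f(3) x(1) e'(1) by (auto simp: A_def)
        then show ?thesis using x e' by auto
      next
        case False
        then show ?thesis using f(1) x by (auto simp: out_def)
      qed
    qed
    then have "card (?SB e) \<le> card ((\<lambda>e'. {b e, b e'}) ` (M - {e}) \<union> (\<lambda>x. {b e, x}) ` out (b e))"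
      using finM fin_out by (intro card_mono) auto
    also have "\<dots> \<le> card (M - {e}) + card (out (b e))"
      using card_Un_le[of "(\<lambda>e'. {b e, b e'}) ` (M - {e})" "(\<lambda>x. {b e, x}) ` out (b e)"]
        card_image_le[of "M - {e}" "\<lambda>e'. {b e, b e'}"]
        card_image_le[OF fin_out, of "\<lambda>x. {b e, x}" "b e"] finM by simp
    also have "\<dots> \<le> card M" using out_b[OF e] card_Suc_Diff1[OF finM e] by simp
    finally show "card (?SB e) \<le> card M" .
  qed
  finally have "card S \<le> card M * max_degree G + card M * card M" by simp
  also have "\<dots> \<le> m * max_degree G + m\<^sup>2"
    using m[OF M] by (simp add: power2_eq_square add_mono mult_le_mono)
  finally show ?thesis .
qed

theorem theorem1p11:
  fixes G :: "'a ugraph" and k :: nat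
  assumes "k \<ge> 3"
    and "simple_graph G"
    and "graph_free (cycle_graph (2 * k)) G"
    and "max_degree G \<ge> 1"
  shows "strong_clique_number G \<le> (2 * k - 1) * max_degree G + (2 * k - 1)\<^sup>2"
proof -
  have "finite (edges G)"
    using assms(2) by (auto simp: simple_graph_def intro!: finite_subset[of "edges G" "Pow (verts G)"])
  then have "finite {S. strong_clique G S}"
    by (rule finite_subset[rotated, OF finite_Pow_iff[THEN iffD2]]) (auto simp: strong_clique_def)
  then have "finite {card S | S. strong_clique G S}" by simp
  moreover have "strong_clique G {}" by (simp add: strong_clique_def)
  moreover have "card S \<le> (2 * k - 1) * max_degree G + (2 * k - 1)\<^sup>2" if S: "strong_clique G S" for S
  proof (rule card_le_of_matching_bound[OF assms(2)])
    show "S \<subseteq> edges G" using S by (simp add: strong_clique_def)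
    show "card M \<le> 2 * k - 1" if "M \<subseteq> S" "pairwise disjnt M" for M
      using strong_clique_matching_less[OF assms(2,3,1) S that] by simp
  qed
  ultimately show ?thesis unfolding strong_clique_number_def by (subst Max_le_iff) auto
qed

end
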